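(* Let $p,q,m$ be positive integers with $p\ge 2$, $n=p+q+m$, and let $i$ be an integer with $1<i\le p$. Let $A=(C_p\oplus C_q\oplus C_m)+T(1,p+q,i,p+q+m)$. Then $A$ is permutation similar to an alternating sign matrix unless one of the following holds (in which case it is not): (i) $p=i=2$ and $1\in\{q,m\}$; (ii) $i=p$ and $q=m=1$; (iii) $i=2$ and $q=m=1$.
   Context: $C_k$ is the $k\times k$ permutation matrix with $1$ in positions $(i+1,i)$ for $1\le i\le k-1$ and in position $(1,k)$ ($C_1=(1)$); $\oplus$ denotes matrix direct sum. $T(i_1,j_1,i_2,j_2)$ (with $i_1\ne i_2$, $j_1\ne j_2$) is the $n\times n$ matrix with $1$ in positions $(i_1,j_1),(i_2,j_2)$, $-1$ in positions $(i_1,j_2),(i_2,j_1)$, $0$ elsewhere. An alternating sign matrix is a square $(0,1,-1)$-matrix in which the non-zero entries of each row and column alternate in sign, beginning and ending with $+1$. Matrices $A,B$ are permutation similar if $B=R^TAR$ for a permutation matrix $R$. *)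

theory Defs
  imports "HOL-Combinatorics.Permutations" "Jordan_Normal_Form.Matrix"
begin

text \<open>
  Library matrices are indexed from 0, whereas the positions in the mathematical text are counted
  from 1. Positions passed as arguments below are 1-based; the shift is made by \<open>Suc\<close>.
\<close>

definition cycle_mat :: "nat \<Rightarrow> int mat" where
  "cycle_mat k = mat k k (\<lambda>(a, b).
     if Suc a = Suc b + 1 \<or> (Suc a = 1 \<and> Suc b = k) then 1 else 0)"

text \<open>The matrix \<open>T(i\<^sub>1,j\<^sub>1,i\<^sub>2,j\<^sub>2)\<close> of order \<open>n\<close>; intended only for \<open>i\<^sub>1 \<noteq> i\<^sub>2\<close> and \<open>j\<^sub>1 \<noteq> j\<^sub>2\<close>.\<close>

definition T_mat :: "nat \<Rightarrow> nat \<Rightarrow> nat \<Rightarrow> nat \<Rightarrow> nat \<Rightarrow> int mat" where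
  "T_mat n i\<^sub>1 j\<^sub>1 i\<^sub>2 j\<^sub>2 = mat n n (\<lambda>(a, b).
     if (Suc a, Suc b) \<in> {(i\<^sub>1, j\<^sub>1), (i\<^sub>2, j\<^sub>2)} then 1
     else if (Suc a, Suc b) \<in> {(i\<^sub>1, j\<^sub>2), (i\<^sub>2, j\<^sub>1)} then -1
     else 0)"

definition alternating_signs :: "int list \<Rightarrow> bool" where
  "alternating_signs xs \<longleftrightarrow>
     (let ys = filter (\<lambda>x. x \<noteq> 0) xs in
        ys \<noteq> [] \<and> hd ys = 1 \<and> last ys = 1 \<and> successively (\<lambda>x y. sgn y = - sgn x) ys)"

definition alternating_sign_matrix :: "int mat \<Rightarrow> bool" where
  "alternating_sign_matrix A \<longleftrightarrow>
     square_mat A \<and> elements_mat A \<subseteq> {0, 1, -1} \<and>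
     (\<forall>v \<in> set (rows A) \<union> set (cols A). alternating_signs (list_of_vec v))"

definition permutation_matrix :: "nat \<Rightarrow> 'a :: semiring_1 mat \<Rightarrow> bool" where
  "permutation_matrix n R \<longleftrightarrow>
     (\<exists>\<pi>. \<pi> permutes {..<n} \<and> R = mat n n (\<lambda>(a, b). if a = \<pi> b then 1 else 0))"

definition permutation_similar :: "'a :: semiring_1 mat \<Rightarrow> 'a mat \<Rightarrow> bool" where
  "permutation_similar A B \<longleftrightarrow>
     square_mat A \<and>
     (\<exists>R. permutation_matrix (dim_row A) R \<and> B = transpose_mat R * A * R)"

end

theory Submission
  imports Defs
begin

text \<open>
  Conjugating by a permutation matrix means choosing a linear order on the indices. Only two rows
  and two columns of \<open>A\<close> contain a \<open>-1\<close>, and each of these has exactly two entries \<open>1\<close> besides it;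
  so the order yields an alternating sign matrix iff in each of the four lines the index of the
  \<open>-1\<close> lies between those of the two ones. Let \<open>a, b\<close> be the two rows and \<open>c, d\<close> the two columns of
  \<open>T\<close>, and let \<open>\<alpha>, \<beta>\<close> be the columns of the ones in rows \<open>a, b\<close> and \<open>u, w\<close> the rows of the ones in
  columns \<open>c, d\<close> of the direct sum. Then the four conditions say that both sequences
  \<open>\<alpha>, d, c, \<beta>\<close> and \<open>w, a, b, u\<close> are monotone. The only possible coincidences are \<open>\<alpha> = b\<close> (\<open>i = p\<close>),
  \<open>\<beta> = a\<close> (\<open>i = 2\<close>), \<open>u = c\<close> (\<open>q = 1\<close>) and \<open>w = d\<close> (\<open>m = 1\<close>), and the exceptional cases are those
  combinations of them that make the two monotone sequences incompatible.
\<close>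

\<comment> \<open>The prefix syntax \<open>inv\<close> of HOL-Algebra hides the one for the inverse function.\<close>
no_notation m_inv ("(\<open>open_block notation=\<open>prefix inv\<close>\<close>inv\<index> _)" [81] 80)

section \<open>Sign patterns of sparse lines\<close>

definition between :: "nat \<Rightarrow> nat \<Rightarrow> nat \<Rightarrow> bool" where
  "between x y z \<longleftrightarrow> (x < y \<and> y < z) \<or> (z < y \<and> y < x)"

lemma between_commute: "between x y z \<longleftrightarrow> between z y x"
  by (auto simp: between_def)

text \<open>A strictly increasing list is determined by its set. Hence the sequence of non-zero
  entries of a line can be computed from the mere set of their positions.\<close>

lemma filter_map_upt_eq:
  assumes "sorted_wrt (<) js" and "set js = {x. x < n \<and> P (g x)}"
  shows "filter P (map g [0..<n]) = map g js"
proof -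
  have "sorted (filter (P \<circ> g) [0..<n])" "distinct (filter (P \<circ> g) [0..<n])"
    by (auto simp: sorted_wrt_filter)
  moreover have "sorted js" "distinct js"
    using assms(1) by (auto simp: strict_sorted_iff)
  moreover have "set (filter (P \<circ> g) [0..<n]) = set js"
    using assms(2) by auto
  ultimately have "filter (P \<circ> g) [0..<n] = js"
    by (intro sorted_distinct_set_unique)
  then show ?thesis
    by (simp add: filter_map)
qed

lemma alternating_signs_single:
  assumes "{x. x < n \<and> g x \<noteq> 0} = {s}" and "g s = 1"
  shows "alternating_signs (map g [0..<n])"
proof -
  have "filter (\<lambda>x. x \<noteq> 0) (map g [0..<n]) = map g [s]"
    using assms(1) by (intro filter_map_upt_eq) auto
  then show ?thesis
    using assms(2) by (simp add: alternating_signs_def)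
qed

text \<open>Of the six possible orders of the three positions, exactly the two with \<open>s\<close>
  in the middle produce the signs 1, -1, 1.\<close>

lemma alternating_signs_three_iff:
  fixes g :: "nat \<Rightarrow> int"
  assumes "{x. x < n \<and> g x \<noteq> 0} = {r, s, t}" and "r \<noteq> t"
    and "g r = 1" "g s = -1" "g t = 1"
  shows "alternating_signs (map g [0..<n]) \<longleftrightarrow> between r s t"
proof -
  have eq: "filter (\<lambda>x. x \<noteq> 0) (map g [0..<n]) = map g [u, v, w]"
    if "{u, v, w} = {r, s, t}" "u < v" "v < w" for u v w
    using that assms(1) by (intro filter_map_upt_eq) auto
  have "r \<noteq> s" "s \<noteq> t"
    using assms(3-5) by auto
  then consider "r < s" "s < t" | "r < t" "t < s" | "s < r" "r < t"
    | "s < t" "t < r" | "t < r" "r < s" | "t < s" "s < r"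
    using \<open>r \<noteq> t\<close> by linarith
  then show ?thesis
  proof cases
    case 1 with eq[of r s t] assms(2-5) show ?thesis
      by (simp add: alternating_signs_def between_def insert_commute)
  next
    case 2 with eq[of r t s] assms(2-5) show ?thesis
      by (simp add: alternating_signs_def between_def insert_commute)
  next
    case 3 with eq[of s r t] assms(2-5) show ?thesis
      by (simp add: alternating_signs_def between_def insert_commute)
  next
    case 4 with eq[of s t r] assms(2-5) show ?thesis
      by (simp add: alternating_signs_def between_def insert_commute)
  next
    case 5 with eq[of t r s] assms(2-5) show ?thesis
      by (simp add: alternating_signs_def between_def insert_commute)
  next
    case 6 with eq[of t s r] assms(2-5) show ?thesis
      by (simp add: alternating_signs_def between_def insert_commute)
  qed
qed

section \<open>Conjugates of a permutation matrix plus T\<close>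

definition perm_plus_T :: "(nat \<Rightarrow> nat) \<Rightarrow> nat \<Rightarrow> nat \<Rightarrow> nat \<Rightarrow> nat \<Rightarrow> nat \<Rightarrow> nat \<Rightarrow> int" where
  "perm_plus_T f a c b d x y = (if y = f x then 1 else 0) +
     (if (x, y) \<in> {(a, c), (b, d)} then 1 else if (x, y) \<in> {(a, d), (b, c)} then -1 else 0)"

text \<open>Column \<open>v\<close> stands at place \<open>inv \<pi> v\<close> of the reordered row.
  The assumptions on \<open>f a\<close> and \<open>f b\<close> keep the ones of the permutation off
  the four positions of T, so nothing cancels or adds up to 2: rows \<open>a\<close> and
  \<open>b\<close> have three non-zero entries and every other row has a single one.\<close>

lemma perm_plus_T_row_alternating_iff:
  assumes f: "f permutes {..<n}" and p: "\<pi> permutes {..<n}"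
    and lt: "a < n" "b < n" "c < n" "d < n" and ne: "a \<noteq> b" "c \<noteq> d"
    and fa: "f a \<noteq> c" "f a \<noteq> d" and fb: "f b \<noteq> c" "f b \<noteq> d" and x: "x < n"
  shows "alternating_signs (map (\<lambda>j. perm_plus_T f a c b d x (\<pi> j)) [0..<n]) \<longleftrightarrow>
    (x = a \<longrightarrow> between (inv \<pi> (f a)) (inv \<pi> d) (inv \<pi> c)) \<and>
    (x = b \<longrightarrow> between (inv \<pi> (f b)) (inv \<pi> c) (inv \<pi> d))"
proof -
  note inv = permutes_inverses[OF p]
  have eq: "\<pi> j = v \<longleftrightarrow> j = inv \<pi> v" for j v
    using inv by metis
  have invlt: "inv \<pi> v < n" if "v < n" for v
    using permutes_in_image[OF permutes_inv[OF p], of v] that by simp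
  have flt: "f v < n" if "v < n" for v
    using permutes_in_image[OF f, of v] that by simp
  have inj: "inv \<pi> u = inv \<pi> v \<longleftrightarrow> u = v" for u v
    using inv by metis
  consider "x = a" | "x = b" | "x \<noteq> a" "x \<noteq> b" by blast
  then show ?thesis
  proof cases
    case 1
    have "alternating_signs (map (\<lambda>j. perm_plus_T f a c b d x (\<pi> j)) [0..<n]) \<longleftrightarrow>
      between (inv \<pi> (f a)) (inv \<pi> d) (inv \<pi> c)"
      using 1 lt ne fa flt[of a] inv
      by (intro alternating_signs_three_iff) (auto simp: perm_plus_T_def eq inj invlt split: if_splits)
    with 1 ne show ?thesis by simp
  next
    case 2
    have "alternating_signs (map (\<lambda>j. perm_plus_T f a c b d x (\<pi> j)) [0..<n]) \<longleftrightarrow>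
      between (inv \<pi> (f b)) (inv \<pi> c) (inv \<pi> d)"
      using 2 lt ne fb flt[of b] inv
      by (intro alternating_signs_three_iff) (auto simp: perm_plus_T_def eq inj invlt split: if_splits)
    with 2 ne show ?thesis by simp
  next
    case 3
    have "alternating_signs (map (\<lambda>j. perm_plus_T f a c b d x (\<pi> j)) [0..<n])"
      using 3 x flt[of x] inv
      by (intro alternating_signs_single[of _ _ "inv \<pi> (f x)"])
         (auto simp: perm_plus_T_def eq inj invlt split: if_splits)
    with 3 show ?thesis by simp
  qed
qed

text \<open>Columns are rows of the transpose, which has the same shape with \<open>f\<close>
  inverted and the roles of \<open>a\<close>, \<open>b\<close> and \<open>c\<close>,
  \<open>d\<close> exchanged. So the column conditions follow from the row lemma.\<close>

lemma perm_plus_T_transpose: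
  assumes "f permutes S"
  shows "perm_plus_T f a c b d x y = perm_plus_T (inv f) c a d b y x"
proof -
  have iff: "y = f x \<longleftrightarrow> x = inv f y"
    using permutes_inv_eq[OF assms, of y x] by auto
  show ?thesis
    unfolding perm_plus_T_def iff by (simp add: conj_commute disj_commute)
qed

lemma permutation_conjugate_mat:
  fixes A :: "'a :: comm_semiring_1 mat"
  assumes A: "A \<in> carrier_mat n n" and p: "\<pi> permutes {..<n}"
    and R: "R = mat n n (\<lambda>(a, b). if a = \<pi> b then 1 else 0)"
  shows "transpose_mat R * A * R = mat n n (\<lambda>(x, y). A $$ (\<pi> x, \<pi> y))"
proof (rule eq_matI)
  have lt: "\<pi> v < n" if "v < n" for v
    using permutes_in_image[OF p, of v] that by simp
  have RA: "(transpose_mat R * A) $$ (x, y) = A $$ (\<pi> x, y)" if "x < n" "y < n" for x y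
    using A that lt[of x]
    by (simp add: R scalar_prod_def if_distrib[of "\<lambda>u. u * _"] sum.delta cong: if_cong)
  fix x y assume "x < dim_row (mat n n (\<lambda>(x, y). A $$ (\<pi> x, \<pi> y)))"
    and "y < dim_col (mat n n (\<lambda>(x, y). A $$ (\<pi> x, \<pi> y)))"
  then have x: "x < n" and y: "y < n" by auto
  have "(transpose_mat R * A * R) $$ (x, y) =
      (\<Sum>k\<in>{0..<n}. (transpose_mat R * A) $$ (x, k) * R $$ (k, y))"
    using A x y by (simp add: R scalar_prod_def)
  also have "\<dots> = (\<Sum>k\<in>{0..<n}. if k = \<pi> y then A $$ (\<pi> x, k) else 0)"
    using RA x y by (intro sum.cong) (auto simp: R)
  also have "\<dots> = A $$ (\<pi> x, \<pi> y)"
    using lt[OF y] by simp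
  finally show "(transpose_mat R * A * R) $$ (x, y) = mat n n (\<lambda>(x, y). A $$ (\<pi> x, \<pi> y)) $$ (x, y)"
    using x y by simp
qed (use A R in auto)

lemma alternating_sign_matrix_mat_iff:
  "alternating_sign_matrix (mat n n (\<lambda>(x, y). g x y)) \<longleftrightarrow>
     (\<forall>x<n. \<forall>y<n. g x y \<in> {0, 1, -1}) \<and>
     (\<forall>x<n. alternating_signs (map (\<lambda>y. g x y) [0..<n])) \<and>
     (\<forall>y<n. alternating_signs (map (\<lambda>x. g x y) [0..<n]))"
proof -
  let ?M = "mat n n (\<lambda>(x, y). g x y)"
  have rows: "set (rows ?M) = (\<lambda>x. vec n (g x)) ` {..<n}"
    by (auto simp: rows_def set_map row_def intro!: image_cong)
  have cols: "set (cols ?M) = (\<lambda>y. vec n (\<lambda>x. g x y)) ` {..<n}"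
    by (auto simp: cols_def set_map col_def intro!: image_cong)
  have list: "list_of_vec (vec n h) = map h [0..<n]" for h :: "nat \<Rightarrow> int"
    by (auto simp: list_of_vec_map)
  have elems: "elements_mat ?M = (\<lambda>(x, y). g x y) ` ({..<n} \<times> {..<n})"
    by (auto simp: elements_mat_def image_iff) (metis atLeastLessThan_iff zero_le)
  show ?thesis
    unfolding alternating_sign_matrix_def rows cols elems ball_Un
    by (auto simp: list)
qed

lemma alternating_sign_matrix_perm_plus_T_iff:
  assumes f: "f permutes {..<n}" and p: "\<pi> permutes {..<n}"
    and lt: "a < n" "b < n" "c < n" "d < n" and ne: "a \<noteq> b" "c \<noteq> d"
    and fa: "f a \<noteq> c" "f a \<noteq> d" and fb: "f b \<noteq> c" "f b \<noteq> d"
  shows "alternating_sign_matrix (mat n n (\<lambda>(x, y). perm_plus_T f a c b d (\<pi> x) (\<pi> y))) \<longleftrightarrow>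
    between (inv \<pi> (f a)) (inv \<pi> d) (inv \<pi> c) \<and> between (inv \<pi> (f b)) (inv \<pi> c) (inv \<pi> d) \<and>
    between (inv \<pi> a) (inv \<pi> b) (inv \<pi> (inv f c)) \<and> between (inv \<pi> b) (inv \<pi> a) (inv \<pi> (inv f d))"
proof -
  \<comment> \<open>All rows have to alternate, so the order in which they are listed is irrelevant;
    \<pi> matters only within each row. The same holds for columns.\<close>
  have all: "(\<forall>x<n. Q (\<pi> x)) \<longleftrightarrow> (\<forall>x<n. Q x)" for Q
  proof -
    have "(\<forall>x\<in>{..<n}. Q x) \<longleftrightarrow> (\<forall>x\<in>\<pi> ` {..<n}. Q x)"
      by (simp only: permutes_image[OF p])
    then show ?thesis by auto
  qed
  have inv: "inv f c \<noteq> a" "inv f c \<noteq> b" "inv f d \<noteq> a" "inv f d \<noteq> b"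
    using fa fb permutes_inverses[OF f] by metis+
  have elems: "perm_plus_T f a c b d x y \<in> {0, 1, -1}" for x y
    using fa fb by (auto simp: perm_plus_T_def)
  have rows: "(\<forall>x<n. alternating_signs (map (\<lambda>y. perm_plus_T f a c b d x (\<pi> y)) [0..<n])) \<longleftrightarrow>
    between (inv \<pi> (f a)) (inv \<pi> d) (inv \<pi> c) \<and> between (inv \<pi> (f b)) (inv \<pi> c) (inv \<pi> d)"
    (is "?L \<longleftrightarrow> ?P \<and> ?Q")
  proof -
    have "?L \<longleftrightarrow> (\<forall>x<n. (x = a \<longrightarrow> ?P) \<and> (x = b \<longrightarrow> ?Q))"
      by (simp add: perm_plus_T_row_alternating_iff[OF f p lt ne fa fb])
    also have "\<dots> \<longleftrightarrow> ?P \<and> ?Q"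
      using lt by blast
    finally show ?thesis .
  qed
  have cols: "(\<forall>y<n. alternating_signs (map (\<lambda>x. perm_plus_T f a c b d (\<pi> x) y) [0..<n])) \<longleftrightarrow>
    between (inv \<pi> a) (inv \<pi> b) (inv \<pi> (inv f c)) \<and> between (inv \<pi> b) (inv \<pi> a) (inv \<pi> (inv f d))"
    (is "?L \<longleftrightarrow> ?P \<and> ?Q")
  proof -
    have "?L \<longleftrightarrow> (\<forall>y<n. (y = c \<longrightarrow> between (inv \<pi> (inv f c)) (inv \<pi> b) (inv \<pi> a)) \<and>
      (y = d \<longrightarrow> between (inv \<pi> (inv f d)) (inv \<pi> a) (inv \<pi> b)))"
      unfolding perm_plus_T_transpose[OF f]
      by (simp add: perm_plus_T_row_alternating_iff
            [OF permutes_inv[OF f] p lt(3,4,1,2) ne(2,1) inv])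
    also have "\<dots> \<longleftrightarrow>
      between (inv \<pi> (inv f c)) (inv \<pi> b) (inv \<pi> a) \<and> between (inv \<pi> (inv f d)) (inv \<pi> a) (inv \<pi> b)"
      using lt by blast
    also have "\<dots> \<longleftrightarrow> ?P \<and> ?Q"
      by (simp only: between_commute)
    finally show ?thesis .
  qed
  show ?thesis
    unfolding alternating_sign_matrix_mat_iff
      all[of "\<lambda>x. alternating_signs (map (\<lambda>y. perm_plus_T f a c b d x (\<pi> y)) [0..<n])"] rows
      all[of "\<lambda>y. alternating_signs (map (\<lambda>x. perm_plus_T f a c b d (\<pi> x) y) [0..<n])"] cols
    using elems by blast
qed

lemma permutation_similar_to_asm_iff:
  assumes A: "A = mat n n (\<lambda>(x, y). perm_plus_T f a c b d x y)" and f: "f permutes {..<n}"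
    and lt: "a < n" "b < n" "c < n" "d < n" and ne: "a \<noteq> b" "c \<noteq> d"
    and fa: "f a \<noteq> c" "f a \<noteq> d" and fb: "f b \<noteq> c" "f b \<noteq> d"
  shows "(\<exists>B. permutation_similar A B \<and> alternating_sign_matrix B) \<longleftrightarrow>
    (\<exists>\<sigma>. \<sigma> permutes {..<n} \<and>
      between (\<sigma> (f a)) (\<sigma> d) (\<sigma> c) \<and> between (\<sigma> (f b)) (\<sigma> c) (\<sigma> d) \<and>
      between (\<sigma> a) (\<sigma> b) (\<sigma> (inv f c)) \<and> between (\<sigma> b) (\<sigma> a) (\<sigma> (inv f d)))"
    (is "_ \<longleftrightarrow> (\<exists>\<sigma>. \<sigma> permutes {..<n} \<and> ?Q \<sigma>)")
proof -
  have carrier: "A \<in> carrier_mat n n" and dims: "square_mat A" "dim_row A = n"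
    by (auto simp: A)
  have conj: "transpose_mat R * A * R = mat n n (\<lambda>(x, y). perm_plus_T f a c b d (\<pi> x) (\<pi> y))"
    if "\<pi> permutes {..<n}" "R = mat n n (\<lambda>(a, b). if a = \<pi> b then 1 else 0)" for \<pi> R
    unfolding permutation_conjugate_mat[OF carrier that]
    using permutes_in_image[OF that(1)] by (intro eq_matI) (auto simp: A)
  \<comment> \<open>Only \<open>inv \<pi>\<close> enters the conditions, so the search may range
    over the position maps \<sigma> themselves.\<close>
  have ex_inv: "(\<exists>\<pi>. \<pi> permutes S \<and> Q (inv \<pi>)) \<longleftrightarrow> (\<exists>\<sigma>. \<sigma> permutes S \<and> Q \<sigma>)"
    for S :: "nat set" and Q
    by (metis permutes_inv permutes_inv_inv)
  have "(\<exists>B. permutation_similar A B \<and> alternating_sign_matrix B) \<longleftrightarrow>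
    (\<exists>\<pi>. \<pi> permutes {..<n} \<and>
      alternating_sign_matrix (mat n n (\<lambda>(x, y). perm_plus_T f a c b d (\<pi> x) (\<pi> y))))"
    unfolding permutation_similar_def permutation_matrix_def dims(2) using dims(1) conj by metis
  also have "\<dots> \<longleftrightarrow> (\<exists>\<pi>. \<pi> permutes {..<n} \<and> ?Q (inv \<pi>))"
    using alternating_sign_matrix_perm_plus_T_iff[OF f _ lt ne fa fb] by blast
  also have "\<dots> \<longleftrightarrow> (\<exists>\<sigma>. \<sigma> permutes {..<n} \<and> ?Q \<sigma>)"
    by (rule ex_inv)
  finally show ?thesis .
qed

section \<open>Realising betweenness conditions by an order\<close>

lemma exists_permutes_strict_sorted_map:
  fixes n :: nat
  assumes "distinct xs" and "set xs \<subseteq> {..<n}"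
  shows "\<exists>\<sigma>. \<sigma> permutes {..<n} \<and> sorted_wrt (<) (map \<sigma> xs)"
proof -
  \<comment> \<open>The prescribed partial order is completed by the remaining indices; the position
    of an index in this full list is the required permutation.\<close>
  define ys where "ys = xs @ filter (\<lambda>x. x \<notin> set xs) [0..<n]"
  have ys: "distinct ys" "set ys = {..<n}"
    using assms by (auto simp: ys_def)
  then have len: "length ys = n"
    using distinct_card by fastforce
  define \<pi> where "\<pi> k = (if k < n then ys ! k else k)" for k
  have "bij_betw ((!) ys) {..<n} {..<n}"
    using ys len by (intro bij_betw_nth) auto
  then have "bij_betw \<pi> {..<n} {..<n}"
    by (rule bij_betw_cong[THEN iffD1, rotated]) (simp add: \<pi>_def)
  then have p: "\<pi> permutes {..<n}"
    by (rule bij_imp_permutes) (simp add: \<pi>_def)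
  have "inv \<pi> (xs ! k) = k" if "k < length xs" for k
  proof -
    have "\<pi> k = xs ! k"
      using that len by (auto simp: \<pi>_def ys_def nth_append)
    then show ?thesis
      using permutes_inverses(2)[OF p, of k] by simp
  qed
  then have "sorted_wrt (<) (map (inv \<pi>) xs)"
    by (simp add: sorted_wrt_iff_nth_less)
  then show ?thesis
    using permutes_inv[OF p] by blast
qed

text \<open>The excluded cases are precisely those in which at least three of the coincidences
  \<open>\<alpha> = b\<close>, \<open>\<beta> = a\<close>, \<open>u = c\<close>,
  \<open>w = d\<close> hold. Then the sequences \<alpha>, d, c, \<beta> and w, a, b, u share three
  indices on whose middle one they disagree. Otherwise they share at most two, and can be merged
  after reversing one of them if necessary.\<close>

lemma exists_permutes_between_iff:
  fixes n a b \<alpha> \<beta> c d u w :: nat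
  assumes lt: "a < n" "b < n" "\<alpha> < n" "\<beta> < n" "c < n" "d < n" "u < n" "w < n"
    and ne: "a \<noteq> b" "\<alpha> \<noteq> \<beta>" "\<alpha> \<noteq> a" "\<beta> \<noteq> b" "c \<noteq> d" "u \<noteq> w" "u \<noteq> d" "w \<noteq> c"
    and disj: "{a, b, \<alpha>, \<beta>} \<inter> {c, d, u, w} = {}"
  shows "(\<exists>\<sigma>. \<sigma> permutes {..<n} \<and>
      between (\<sigma> \<alpha>) (\<sigma> d) (\<sigma> c) \<and> between (\<sigma> \<beta>) (\<sigma> c) (\<sigma> d) \<and>
      between (\<sigma> a) (\<sigma> b) (\<sigma> u) \<and> between (\<sigma> b) (\<sigma> a) (\<sigma> w)) \<longleftrightarrow>
    \<not> ((\<alpha> = b \<and> \<beta> = a \<and> (u = c \<or> w = d)) \<or> ((\<alpha> = b \<or> \<beta> = a) \<and> u = c \<and> w = d))"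
    (is "?L \<longleftrightarrow> \<not> ?E")
proof
  assume ?L
  then show "\<not> ?E"
    unfolding between_def by (elim exE) (safe; linarith)
next
  assume E: "\<not> ?E"
  have ex: ?L if "distinct xs" "set xs \<subseteq> {..<n}"
    "\<And>\<sigma>. sorted_wrt (<) (map \<sigma> xs) \<Longrightarrow>
      between (\<sigma> \<alpha>) (\<sigma> d) (\<sigma> c) \<and> between (\<sigma> \<beta>) (\<sigma> c) (\<sigma> d) \<and>
      between (\<sigma> a) (\<sigma> b) (\<sigma> u) \<and> between (\<sigma> b) (\<sigma> a) (\<sigma> w)" for xs
    using exists_permutes_strict_sorted_map[OF that(1,2)] that(3) by blast
  \<comment> \<open>Each witness lists \<alpha>, d, c, \<beta> in this order, merged with w, a, b,
    u, which is reversed in cases 1, 3 and 5. The conditional pieces avoid listing a coinciding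
    index twice.\<close>
  consider "\<alpha> = b" "\<beta> = a" "u \<noteq> c" "w \<noteq> d"
    | "\<alpha> = b" "\<beta> \<noteq> a" "w \<noteq> d" | "\<alpha> = b" "\<beta> \<noteq> a" "w = d" "u \<noteq> c"
    | "\<alpha> \<noteq> b" "\<beta> = a" "u \<noteq> c" | "\<alpha> \<noteq> b" "\<beta> = a" "u = c" "w \<noteq> d"
    | "\<alpha> \<noteq> b" "\<beta> \<noteq> a"
    using E by blast
  then show ?L
  proof cases
    case 1
    show ?thesis
      by (rule ex[of "[u, b, d, c, a, w]"]) (use 1 lt ne disj in \<open>auto simp: between_def\<close>)
  next
    case 2
    show ?thesis
      by (rule ex[of "[w, a, b, d, c] @ (if u = c then [] else [u]) @ [\<beta>]"])
         (use 2 lt ne disj in \<open>auto simp: between_def split: if_splits\<close>)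
  next
    case 3
    show ?thesis
      by (rule ex[of "[u, b, a, d, c, \<beta>]"]) (use 3 lt ne disj in \<open>auto simp: between_def\<close>)
  next
    case 4
    show ?thesis
      by (rule ex[of "[\<alpha>] @ (if w = d then [] else [w]) @ [d, c, a, b, u]"])
         (use 4 lt ne disj in \<open>auto simp: between_def split: if_splits\<close>)
  next
    case 5
    show ?thesis
      by (rule ex[of "[\<alpha>, d, c, b, a, w]"]) (use 5 lt ne disj in \<open>auto simp: between_def\<close>)
  next
    case 6
    show ?thesis
      by (rule ex[of "(if w = d then [] else [w]) @ [\<alpha>, d, a, b, c] @ (if u = c then [] else [u]) @ [\<beta>]"])
         (use 6 lt ne disj in \<open>auto simp: between_def split: if_splits\<close>)
  qed
qed

section \<open>Specialisation to three cycles\<close>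

lemma cycle_mat_carrier [simp]: "dim_row (cycle_mat k) = k" "dim_col (cycle_mat k) = k"
  by (simp_all add: cycle_mat_def)

lemma cycle_mat_index:
  assumes "x < k" and "y < k"
  shows "cycle_mat k $$ (x, y) = (if y = (if x = 0 then k - 1 else x - 1) then 1 else 0)"
  using assms by (simp add: cycle_mat_def) (cases x; force)

lemma diag_block_mat_three_index:
  assumes "dim_row A = p" "dim_col A = p" "dim_row B = q" "dim_col B = q"
    and "dim_row C = m" "dim_col C = m" and "x < p + q + m" "y < p + q + m"
  shows "diag_block_mat [A, B, C] $$ (x, y) =
    (if x < p then if y < p then A $$ (x, y) else 0
     else if x < p + q then if p \<le> y \<and> y < p + q then B $$ (x - p, y - p) else 0
     else if p + q \<le> y then C $$ (x - p - q, y - p - q) else 0)"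
  using assms
  by (cases "x < p"; cases "y < p"; cases "x < p + q"; cases "y < p + q")
     (simp_all add: Let_def not_less less_diff_conv2)

theorem theorem5p5:
  fixes p q m n i :: nat and A :: "int mat"
  assumes "p \<ge> 2" and "q \<ge> 1" and "m \<ge> 1" and "n = p + q + m"
    and "1 < i" and "i \<le> p"
    and "A = diag_block_mat [cycle_mat p, cycle_mat q, cycle_mat m]
             + T_mat n 1 (p + q) i (p + q + m)"
  shows "(\<exists>B. permutation_similar A B \<and> alternating_sign_matrix B) \<longleftrightarrow>
         \<not> ((p = 2 \<and> i = 2 \<and> 1 \<in> {q, m}) \<or>
            (i = p \<and> q = 1 \<and> m = 1) \<or>
            (i = 2 \<and> q = 1 \<and> m = 1))"
proof -
  \<comment> \<open>\<open>f\<close> sends a row of the direct sum to the column of its one: one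
    step back within the block, the block starts 0, p and p + q wrapping round. \<open>g\<close> is
    its inverse in closed form. Both fix everything from \<open>n\<close> on, as
    \<open>permutes\<close> demands.\<close>
  define f where "f x = (if x = 0 then p - 1 else if x = p then p + q - 1
    else if x = p + q then n - 1 else if x < n then x - 1 else x)" for x
  define g where "g y = (if y = p - 1 then 0 else if y = p + q - 1 then p
    else if y = n - 1 then p + q else if y < n then y + 1 else y)" for y
  note le = assms(1-6)
  have gf: "g (f x) = x" for x
  proof -
    consider "x = 0" | "x = p" | "x = p + q" | "x < n" "x \<notin> {0, p, p + q}" | "x \<ge> n"
      by fastforce
    then show ?thesis
      using le by cases (simp_all add: f_def g_def, linarith+)
  qed
  have fg: "f (g y) = y" for y
  proof -
    consider "y = p - 1" | "y = p + q - 1" | "y = n - 1"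
      | "y < n" "y \<notin> {p - 1, p + q - 1, n - 1}" | "y \<ge> n"
      by fastforce
    then show ?thesis
      using le by cases (simp_all add: f_def g_def, linarith+)
  qed
  have f: "f permutes {..<n}"
    unfolding permutes_def
  proof (intro conjI allI impI)
    show "f x = x" if "x \<notin> {..<n}" for x
      using that le by (auto simp: f_def)
    show "\<exists>!x. f x = y" for y
      using gf fg by metis
  qed
  have inv: "inv f = g"
    using gf fg by (intro inv_unique_comp) auto
  have A: "A = mat n n (\<lambda>(x, y). perm_plus_T f 0 (p + q - 1) (i - 1) (n - 1) x y)"
  proof (rule eq_matI)
    fix x y assume "x < dim_row (mat n n (\<lambda>(x, y). perm_plus_T f 0 (p + q - 1) (i - 1) (n - 1) x y))"
      and "y < dim_col (mat n n (\<lambda>(x, y). perm_plus_T f 0 (p + q - 1) (i - 1) (n - 1) x y))"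
    then have xy: "x < n" "y < n" by auto
    have cyc: "diag_block_mat [cycle_mat p, cycle_mat q, cycle_mat m] $$ (x, y) =
        (if y = f x then 1 else 0)"
    proof -
      note index = diag_block_mat_three_index[OF cycle_mat_carrier cycle_mat_carrier
          cycle_mat_carrier xy[unfolded assms(4)]]
      consider "x < p" | "p \<le> x" "x < p + q" | "p + q \<le> x"
        by linarith
      then show ?thesis
      proof cases
        case 1
        with xy le show ?thesis
          unfolding index by (auto simp: cycle_mat_index f_def)
      next
        case 2
        with xy le show ?thesis
          unfolding index by (cases "x = p") (auto simp: cycle_mat_index f_def)
      next
        case 3
        with xy le show ?thesis
          unfolding index by (cases "x = p + q") (auto simp: cycle_mat_index f_def)
      qed
    qed
    have T: "T_mat n 1 (p + q) i (p + q + m) $$ (x, y) =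
      (if (x, y) \<in> {(0, p + q - 1), (i - 1, n - 1)} then 1
       else if (x, y) \<in> {(0, n - 1), (i - 1, p + q - 1)} then -1 else 0)"
      using xy le by (auto simp: T_mat_def)
    show "A $$ (x, y) = mat n n (\<lambda>(x, y). perm_plus_T f 0 (p + q - 1) (i - 1) (n - 1) x y) $$ (x, y)"
      using xy cyc T by (simp add: assms(7) perm_plus_T_def T_mat_def)
  qed (auto simp: assms(7) T_mat_def)
  \<comment> \<open>These are \<alpha>, \<beta>, u and w for the 0-based rows 0, i - 1 and columns p
    + q - 1, n - 1 of T.\<close>
  have vals: "f 0 = p - 1" "f (i - 1) = i - 2" "inv f (p + q - 1) = p" "inv f (n - 1) = p + q"
    using le by (auto simp: f_def g_def inv)
  have "(\<exists>B. permutation_similar A B \<and> alternating_sign_matrix B) \<longleftrightarrow>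
    (\<exists>\<sigma>. \<sigma> permutes {..<n} \<and>
      between (\<sigma> (p - 1)) (\<sigma> (n - 1)) (\<sigma> (p + q - 1)) \<and>
      between (\<sigma> (i - 2)) (\<sigma> (p + q - 1)) (\<sigma> (n - 1)) \<and>
      between (\<sigma> 0) (\<sigma> (i - 1)) (\<sigma> p) \<and> between (\<sigma> (i - 1)) (\<sigma> 0) (\<sigma> (p + q)))"
    by (intro permutation_similar_to_asm_iff[OF A f, unfolded vals]) (use le in linarith)+
  also have "\<dots> \<longleftrightarrow> \<not> ((p - 1 = i - 1 \<and> i - 2 = 0 \<and> (p = p + q - 1 \<or> p + q = n - 1)) \<or>
      ((p - 1 = i - 1 \<or> i - 2 = 0) \<and> p = p + q - 1 \<and> p + q = n - 1))"
    \<comment> \<open>The indices 0, i - 1, p - 1, i - 2 lie in the first block and the other four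
      in the last two blocks, which gives the disjointness.\<close>
    using le by (intro exists_permutes_between_iff) auto
  also have "\<dots> \<longleftrightarrow> \<not> ((p = 2 \<and> i = 2 \<and> 1 \<in> {q, m}) \<or>
            (i = p \<and> q = 1 \<and> m = 1) \<or>
            (i = 2 \<and> q = 1 \<and> m = 1))"
  proof -
    \<comment> \<open>Subtraction is truncated, so the bounds matter: for instance
      \<open>i - 2 = 0\<close> means \<open>i = 2\<close> only because of
      \<open>1 < i\<close>.\<close>
    have "p - 1 = i - 1 \<longleftrightarrow> i = p" "i - 2 = 0 \<longleftrightarrow> i = 2"
      "p = p + q - 1 \<longleftrightarrow> q = 1" "p + q = n - 1 \<longleftrightarrow> m = 1"
      using le by linarith+
    then show ?thesis by auto
  qed
  finally show ?thesis .
qed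

end
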